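(* Let $(X,\|\cdot\|)$ be a cylindrical normed space. If $m\ge6$, then there is a placement $p$ of the complete graph $K_m$ in $X$ such that $(K_m,p)$ is well-positioned and infinitesimally rigid in $(X,\|\cdot\|)$.
   Context: A cylindrical normed space is a real normed space isometrically isomorphic to $(\mathbb{R}^3,\|\cdot\|_{\mathrm{cyl}})$, where $\|(x,y,z)\|_{\mathrm{cyl}}=\max\{\sqrt{x^2+y^2},|z|\}$. $K_m$ is the complete graph on $m$ vertices ($m$ a positive integer). Frameworks. For a finite simple graph $G=(V,E)$, a bar-joint framework $(G,p)$ in $X$ is $G$ with a map (placement) $p:V\to X$, $v\mapsto p_v$, such that $p_v\ne p_w$ for all $vw\in E$. A support functional for a unit vector $x_0\in X$ is a linear functional $f:X\to\mathbb{R}$ with $\|f\|\le1$ and $f(x_0)=1$; the norm is smooth at $x\neq0$ if $x/\|x\|$ has exactly one support functional. $(G,p)$ is well-positioned if the norm is smooth at $p_v-p_w$ for every $vw\in E$. A rigid motion of $(X,\|\cdot\|)$ is a family of continuous paths $\{\alpha_x:[-1,1]\to X\}_{x\in X}$ with $\alpha_x(0)=x$, $\alpha_x$ differentiable at $0$, and $\|\alpha_x(t)-\alpha_y(t)\|=\|x-y\|$ for all $x,y\in X$, $t\in[-1,1]$. $\mathcal{T}(X,\|\cdot\|)$ is the space of maps $\eta:X\to X$, $\eta(x)=\alpha_x'(0)$. With $f_G:X^V\to\mathbb{R}^E$, $f_G((x_v)_v)=(\|x_v-x_w\|)_{vw\in E}$, an infinitesimal flex of $(G,p)$ is $z\in X^V$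 with $\lim_{t\to0}\frac1t(f_G(p+tz)-f_G(p))=0$; it is trivial if $z=\eta\circ p$ for some $\eta\in\mathcal{T}(X,\|\cdot\|)$. $(G,p)$ is infinitesimally rigid if every infinitesimal flex is trivial. *)

theory Defs
  imports "HOL-Analysis.Analysis"
begin

definition cyl_norm :: "real ^ 3 \<Rightarrow> real" where
  "cyl_norm u = max (sqrt ((u $ 1)\<^sup>2 + (u $ 2)\<^sup>2)) \<bar>u $ 3\<bar>"

definition cylindrical_normed_space :: "'a::real_normed_vector itself \<Rightarrow> bool" where
  "cylindrical_normed_space _ \<longleftrightarrow>
     (\<exists>\<Phi> :: 'a \<Rightarrow> real ^ 3. linear \<Phi> \<and> bij \<Phi> \<and> (\<forall>x. cyl_norm (\<Phi> x) = norm x))"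


text \<open>A graph is a pair of a vertex set and a set of two-element subsets of it.  A placement
  (and likewise an element of \<open>X\<^sup>V\<close>) is a total function, of which only the values on the
  vertex set matter.\<close>

type_synonym 'v graph = "'v set \<times> 'v set set"

definition finite_simple_graph :: "'v graph \<Rightarrow> bool" where
  "finite_simple_graph G \<longleftrightarrow> finite (fst G) \<and> (\<forall>e\<in>snd G. e \<subseteq> fst G \<and> card e = 2)"

definition complete_graph :: "nat \<Rightarrow> nat graph" where
  "complete_graph m = ({..<m}, {e. e \<subseteq> {..<m} \<and> card e = 2})"

definition framework :: "'v graph \<Rightarrow> ('v \<Rightarrow> 'a::real_normed_vector) \<Rightarrow> bool" where
  "framework G p \<longleftrightarrow> finite_simple_graph G \<and> (\<forall>v w. {v, w} \<in> snd G \<longrightarrow> p v \<noteq> p w)"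


text \<open>Boundedness is part of the condition that the dual norm is at most 1, since
  \<^const>\<open>onorm\<close> is meaningless for unbounded functionals.\<close>

definition support_functional :: "'a::real_normed_vector \<Rightarrow> ('a \<Rightarrow> real) \<Rightarrow> bool" where
  "support_functional x0 f \<longleftrightarrow> norm x0 = 1 \<and> bounded_linear f \<and> onorm f \<le> 1 \<and> f x0 = 1"

definition norm_smooth_at :: "'a::real_normed_vector \<Rightarrow> bool" where
  "norm_smooth_at x \<longleftrightarrow> x \<noteq> 0 \<and> (\<exists>!f. support_functional (x /\<^sub>R norm x) f)"

definition well_positioned :: "'v graph \<Rightarrow> ('v \<Rightarrow> 'a::real_normed_vector) \<Rightarrow> bool" where
  "well_positioned G p \<longleftrightarrow>
     framework G p \<and> (\<forall>v w. {v, w} \<in> snd G \<longrightarrow> norm_smooth_at (p v - p w))"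


definition rigid_motion :: "('a::real_normed_vector \<Rightarrow> real \<Rightarrow> 'a) \<Rightarrow> bool" where
  "rigid_motion \<alpha> \<longleftrightarrow>
     (\<forall>x. continuous_on {-1..1} (\<alpha> x) \<and> \<alpha> x 0 = x \<and> \<alpha> x differentiable (at 0)) \<and>
     (\<forall>x y. \<forall>t\<in>{-1..1}. norm (\<alpha> x t - \<alpha> y t) = norm (x - y))"

definition infinitesimal_rigid_motions :: "('a::real_normed_vector \<Rightarrow> 'a) set" where
  "infinitesimal_rigid_motions =
     {\<eta>. \<exists>\<alpha>. rigid_motion \<alpha> \<and> (\<forall>x. (\<alpha> x has_vector_derivative \<eta> x) (at 0))}"


text \<open>The map \<open>f\<^sub>G\<close> takes values in the finite product \<open>\<real>\<^sup>E\<close>, so the limit defining a flex is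
  taken in each edge coordinate separately.\<close>

definition edge_length :: "('v \<Rightarrow> 'a::real_normed_vector) \<Rightarrow> 'v \<Rightarrow> 'v \<Rightarrow> real" where
  "edge_length x v w = norm (x v - x w)"

definition infinitesimal_flex ::
  "'v graph \<Rightarrow> ('v \<Rightarrow> 'a::real_normed_vector) \<Rightarrow> ('v \<Rightarrow> 'a) \<Rightarrow> bool" where
  "infinitesimal_flex G p z \<longleftrightarrow>
     (\<forall>v w. {v, w} \<in> snd G \<longrightarrow>
        ((\<lambda>t. 1 / t * (edge_length (\<lambda>u. p u + t *\<^sub>R z u) v w - edge_length p v w))
           \<longlongrightarrow> 0) (at 0))"

definition trivial_flex ::
  "'v graph \<Rightarrow> ('v \<Rightarrow> 'a::real_normed_vector) \<Rightarrow> ('v \<Rightarrow> 'a) \<Rightarrow> bool" where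
  "trivial_flex G p z \<longleftrightarrow>
     infinitesimal_flex G p z \<and>
     (\<exists>\<eta>\<in>infinitesimal_rigid_motions. \<forall>v\<in>fst G. z v = \<eta> (p v))"

definition infinitesimally_rigid :: "'v graph \<Rightarrow> ('v \<Rightarrow> 'a::real_normed_vector) \<Rightarrow> bool" where
  "infinitesimally_rigid G p \<longleftrightarrow>
     framework G p \<and> (\<forall>z. infinitesimal_flex G p z \<longrightarrow> trivial_flex G p z)"

end

theory Submission
  imports Defs
begin

text \<open>
  Off the cone \<open>x\<^sup>2 + y\<^sup>2 = z\<^sup>2\<close> the cylindrical norm is locally either the Euclidean norm of the
  horizontal part or the absolute value of the vertical coordinate.  Hence it is smooth there, and
  a first-order length condition on an edge with such a direction sees only one half of the
  velocities: a ``horizontal'' edge constrains the two horizontal coordinates exactly as a bar in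
  the Euclidean plane does, and a ``vertical'' edge says that its two ends have the same vertical
  velocity.  The translations and the rotations about the vertical axis are rigid motions.
  So a placement is infinitesimally rigid as soon as the vertical edges connect
  all vertices and the horizontal edges form an infinitesimally rigid bar framework in the plane.

  Vertex \<open>i\<close> is placed at \<open>(i + 1, 1 / (i + 1), 0)\<close> if \<open>i\<close> is even and at
  \<open>(i + 1, 1 / (i + 1), 2)\<close> if \<open>i\<close> is odd.  Two consecutive vertices have horizontal distance
  below \<open>2\<close>, so their edge is vertical; two non-consecutive vertices either have the same
  height or have horizontal distance at least \<open>3\<close>, so their edge is horizontal.  The vertical edges
  therefore form a path through all vertices, which is connected.  The horizontal edges form the
  complement of that path.  No three points of a hyperbola are collinear, so a vertex
  joined to two vertices of an infinitesimally rigid framework extends it rigidly; starting from the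
  edge \<open>{0, 2}\<close> one attaches every \<open>k \<ge> 4\<close> to \<open>0\<close> and \<open>2\<close>, then \<open>3\<close> to \<open>0\<close> and \<open>5\<close>, and
  finally \<open>1\<close> to \<open>4\<close> and \<open>5\<close>.  The last two steps are where six vertices are
  needed.
\<close>

section \<open>Directional derivatives of the norm\<close>

lemma has_real_derivative_cong_nhds:
  fixes f g :: "real \<Rightarrow> real"
  assumes "(f has_real_derivative D) (at x)" and "eventually (\<lambda>t. g t = f t) (nhds x)"
  shows "(g has_real_derivative D) (at x)"
  using assms(1) DERIV_cong_ev[OF refl assms(2) refl, of D] by simp

text \<open>A support functional \<open>f\<close> lies below the norm and touches it at \<open>x\<close>, so along each line through
  \<open>x\<close> the difference has a minimum at \<open>x\<close>; this forces \<open>f\<close> to be the directional derivative.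
  Conversely a linear directional derivative is bounded by the norm by the triangle inequality.\<close>

lemma norm_smooth_at_if_directional_derivative:
  fixes x :: "'a::real_normed_vector"
  assumes "x \<noteq> 0" and lin: "linear L"
    and der: "\<And>y. ((\<lambda>t. norm (x + t *\<^sub>R y)) has_real_derivative L y) (at 0)"
  shows "norm_smooth_at x"
proof -
  have bound: "\<bar>L y\<bar> \<le> norm y" for y
  proof -
    have "((\<lambda>t. \<bar>(norm (x + t *\<^sub>R y) - norm x) / t\<bar>) \<longlongrightarrow> \<bar>L y\<bar>) (at 0)"
      using der[of y] by (intro tendsto_rabs) (simp add: DERIV_def)
    moreover have "eventually (\<lambda>t. \<bar>(norm (x + t *\<^sub>R y) - norm x) / t\<bar> \<le> norm y) (at 0)"
    proof (rule eventually_at_ball'[of 1 0 UNIV, THEN eventually_mono])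
      fix t :: real assume t: "t \<in> ball 0 1 \<and> t \<noteq> 0 \<and> t \<in> UNIV"
      have "\<bar>norm (x + t *\<^sub>R y) - norm x\<bar> \<le> norm (t *\<^sub>R y)"
        using norm_triangle_ineq3[of "x + t *\<^sub>R y" x] by simp
      with t show "\<bar>(norm (x + t *\<^sub>R y) - norm x) / t\<bar> \<le> norm y"
        by (simp add: divide_simps mult.commute)
    qed simp
    ultimately show ?thesis
      by (rule tendsto_upperbound) simp
  qed
  have Lx: "L x = norm x"
  proof -
    have "((\<lambda>t. (1 + t) * norm x) has_real_derivative norm x) (at 0)"
      by (auto intro!: derivative_eq_intros)
    moreover have "eventually (\<lambda>t. norm (x + t *\<^sub>R x) = (1 + t) * norm x) (nhds 0)"
      unfolding eventually_nhds_metric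
    proof (intro exI[of _ 1] conjI allI impI)
      fix t :: real assume "dist t 0 < 1"
      then have "\<bar>1 + t\<bar> = 1 + t" by (simp add: dist_real_def)
      moreover have "x + t *\<^sub>R x = (1 + t) *\<^sub>R x" by (simp add: scaleR_add_left)
      ultimately show "norm (x + t *\<^sub>R x) = (1 + t) * norm x" by simp
    qed simp
    ultimately have "((\<lambda>t. norm (x + t *\<^sub>R x)) has_real_derivative norm x) (at 0)"
      by (rule has_real_derivative_cong_nhds)
    with der[of x] show ?thesis by (rule DERIV_unique)
  qed
  have nx: "norm (x /\<^sub>R norm x) = 1" using \<open>x \<noteq> 0\<close> by simp
  have bl: "bounded_linear L"
    using bound lin
    by (auto intro!: bounded_linear_intro[where K = 1] simp: linear_add linear_scale)
  have "onorm L \<le> 1"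
    by (rule onorm_bound) (simp_all add: bound)
  moreover have "L (x /\<^sub>R norm x) = 1"
    using \<open>x \<noteq> 0\<close> by (simp add: linear_scale[OF lin] Lx)
  ultimately have ex: "support_functional (x /\<^sub>R norm x) L"
    using nx bl unfolding support_functional_def by blast
  have unique: "f = L" if f: "support_functional (x /\<^sub>R norm x) f" for f
  proof
    fix y
    have fbl: "bounded_linear f" and on: "onorm f \<le> 1" and f1: "f (x /\<^sub>R norm x) = 1"
      using f unfolding support_functional_def by auto
    interpret f: bounded_linear f by fact
    have fx: "f x = norm x"
      using f1 \<open>x \<noteq> 0\<close> by (simp add: f.scaleR divide_simps)
    have le: "f v \<le> norm v" for v
    proof -
      have "norm (f v) \<le> onorm f * norm v" by (rule onorm[OF fbl])
      also have "\<dots> \<le> norm v" using mult_right_mono[OF on, of "norm v"] by simp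
      finally show ?thesis by simp
    qed
    have "((\<lambda>t. norm (x + t *\<^sub>R y) - t * f y) has_real_derivative L y - f y) (at 0)"
      by (auto intro!: derivative_eq_intros der)
    moreover have "norm x \<le> norm (x + t *\<^sub>R y) - t * f y" for t
      using le[of "x + t *\<^sub>R y"] by (simp add: f.add f.scaleR fx)
    ultimately have "L y - f y = 0"
      by (intro DERIV_local_min[where d = 1]) auto
    then show "f y = L y" by simp
  qed
  show ?thesis
    unfolding norm_smooth_at_def using \<open>x \<noteq> 0\<close> ex unique by blast
qed

text \<open>The second branch is the derivative where the vertical part dominates; on the cone itself,
  where the norm is not differentiable, its value is only a default.\<close>

definition cyl_gradient :: "real ^ 3 \<Rightarrow> real ^ 3 \<Rightarrow> real" where
  "cyl_gradient u v =
     (if \<bar>u $ 3\<bar> < sqrt ((u $ 1)\<^sup>2 + (u $ 2)\<^sup>2)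
      then (u $ 1 * v $ 1 + u $ 2 * v $ 2) / sqrt ((u $ 1)\<^sup>2 + (u $ 2)\<^sup>2)
      else sgn (u $ 3) * v $ 3)"

lemma linear_cyl_gradient: "linear (cyl_gradient u)"
  by (rule linearI) (auto simp: cyl_gradient_def algebra_simps add_divide_distrib)

text \<open>Off the cone the larger of the two parts stays the larger one nearby, and it is
  differentiable because it is positive.\<close>

lemma cyl_norm_directional_derivative:
  fixes u v :: "real ^ 3"
  assumes off_cone: "(u $ 1)\<^sup>2 + (u $ 2)\<^sup>2 \<noteq> (u $ 3)\<^sup>2"
  shows "((\<lambda>t. cyl_norm (u + t *\<^sub>R v)) has_real_derivative cyl_gradient u v) (at 0)"
proof -
  define h where "h t = sqrt ((u $ 1 + t * v $ 1)\<^sup>2 + (u $ 2 + t * v $ 2)\<^sup>2)" for t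
  define g where "g t = \<bar>u $ 3 + t * v $ 3\<bar>" for t
  have norm_eq: "cyl_norm (u + t *\<^sub>R v) = max (h t) (g t)" for t
    by (simp add: cyl_norm_def h_def g_def)
  have "isCont h 0" "isCont g 0"
    unfolding h_def g_def by (intro continuous_intros)+
  then have h_lim: "(h \<longlongrightarrow> h 0) (nhds 0)" and g_lim: "(g \<longlongrightarrow> g 0) (nhds 0)"
    by (simp_all add: isCont_def tendsto_at_iff_tendsto_nhds)
  have "h 0 \<noteq> g 0"
  proof
    assume "h 0 = g 0"
    then have "(h 0)\<^sup>2 = (g 0)\<^sup>2" by simp
    with off_cone show False by (simp add: h_def g_def)
  qed
  then consider "g 0 < h 0" | "h 0 < g 0" by linarith
  then show ?thesis
  proof cases
    case 1
    moreover have "0 \<le> g 0" by (simp add: g_def)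
    ultimately have "0 < h 0" by linarith
    then have pos: "0 < (u $ 1)\<^sup>2 + (u $ 2)\<^sup>2" by (simp add: h_def)
    have "(h has_real_derivative (2 * (u $ 1 * v $ 1 + u $ 2 * v $ 2)) / (2 * sqrt ((u $ 1)\<^sup>2 + (u $ 2)\<^sup>2))) (at 0)"
      unfolding h_def
      using pos by (auto intro!: derivative_eq_intros simp: field_simps)
    then have "(h has_real_derivative cyl_gradient u v) (at 0)"
      using 1 unfolding mult_divide_mult_cancel_left[OF zero_neq_numeral[symmetric]]
      by (simp add: cyl_gradient_def h_def g_def)
    moreover have "eventually (\<lambda>t. cyl_norm (u + t *\<^sub>R v) = h t) (nhds 0)"
      using order_tendstoD[OF tendsto_diff[OF h_lim g_lim], of 0] 1
      by (auto elim!: eventually_mono simp: norm_eq)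
    ultimately show ?thesis
      by (rule has_real_derivative_cong_nhds)
  next
    case 2
    moreover have "0 \<le> h 0" by (simp add: h_def)
    ultimately have "0 < g 0" by linarith
    then have nz: "u $ 3 \<noteq> 0" by (simp add: g_def)
    define k where "k t = sgn (u $ 3) * (u $ 3 + t * v $ 3)" for t
    have k_der: "(k has_real_derivative cyl_gradient u v) (at 0)"
      unfolding k_def using 2
      by (auto intro!: derivative_eq_intros simp: cyl_gradient_def h_def g_def)
    then have k_lim: "(k \<longlongrightarrow> k 0) (nhds 0)"
      using DERIV_isCont by (simp add: isCont_def tendsto_at_iff_tendsto_nhds)
    have "0 < k 0"
      using nz by (simp add: k_def sgn_if)
    then have "eventually (\<lambda>t. 0 < k t) (nhds 0)"
      by (rule order_tendstoD(1)[OF k_lim])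
    moreover have "eventually (\<lambda>t. 0 < g t - h t) (nhds 0)"
      by (rule order_tendstoD(1)[OF tendsto_diff[OF g_lim h_lim]]) (use 2 in simp)
    ultimately have "eventually (\<lambda>t. cyl_norm (u + t *\<^sub>R v) = k t) (nhds 0)"
    proof eventually_elim
      case (elim t)
      have "\<bar>x\<bar> = sgn y * x" if "0 < sgn y * x" for x y :: real
        using that by (cases y "0::real" rule: linorder_cases) simp_all
      then have "g t = k t" using elim(1) unfolding g_def k_def by blast
      with elim(2) show ?case by (simp add: norm_eq)
    qed
    with k_der show ?thesis
      by (rule has_real_derivative_cong_nhds)
  qed
qed

section \<open>Rigidity of the complement of a path on a hyperbola\<close>

text \<open>The numbers \<open>a v\<close> and \<open>b v\<close> are the velocities of the point \<open>(v + 1, 1 / (v + 1))\<close>.  The direction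
  from the point with parameter \<open>s\<close> to the one with parameter \<open>t\<close> is \<open>(1, - 1 / (s * t))\<close>, which turns
  the bar condition into the hypothesis below.  The conclusion is that the velocities are
  those of a translation plus a rotation with angular velocity \<open>\<omega>\<close>.\<close>

lemma path_complement_on_hyperbola_rigid:
  fixes a b :: "nat \<Rightarrow> real"
  assumes "m \<ge> 6"
    and bar: "\<And>v w. v < m \<Longrightarrow> w < m \<Longrightarrow> v + 1 < w \<Longrightarrow>
      (real v + 1) * (real w + 1) * (a v - a w) = b v - b w"
  shows "\<exists>\<omega> \<alpha> \<beta>. \<forall>v<m. a v = \<alpha> - \<omega> / (real v + 1) \<and> b v = \<beta> + \<omega> * (real v + 1)"
proof -
  \<comment> \<open>The motion that agrees with the given velocities at the vertices 0 and 2; after subtracting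
    it, these two vertices are at rest.\<close>
  define \<omega> where "\<omega> = (b 2 - b 0) / 2"
  define \<alpha> where "\<alpha> = a 0 + \<omega>"
  define \<beta> where "\<beta> = b 0 - \<omega>"
  define A where "A v = a v - \<alpha> + \<omega> / (real v + 1)" for v
  define B where "B v = b v - \<beta> - \<omega> * (real v + 1)" for v
  have bar': "(real v + 1) * (real w + 1) * (A v - A w) = B v - B w"
    if "v < m" "w < m" "v + 1 < w" for v w
  proof -
    have "(real v + 1) * (real w + 1) * (\<omega> / (real v + 1) - \<omega> / (real w + 1)) = \<omega> * (real w - real v)"
    proof -
      have "s * t * (\<omega> / s - \<omega> / t) = \<omega> * (t - s)" if "s \<noteq> 0" "t \<noteq> 0" for s t :: real
        using that by (simp add: field_simps)
      from this[of "real v + 1" "real w + 1"] show ?thesis by simp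
    qed
    with bar[OF that] show ?thesis
      unfolding A_def B_def by (simp add: algebra_simps)
  qed
  define adj where "adj v w \<longleftrightarrow> v + 1 < w \<or> w + 1 < v" for v w :: nat
  have edge: "(real v + 1) * (real w + 1) * (A v - A w) = B v - B w"
    if "v < m" "w < m" "adj v w" for v w
    using that bar'[of v w] bar'[of w v] unfolding adj_def
    by (auto simp: algebra_simps)
  \<comment> \<open>Each bar from \<open>k\<close> to a vertex at rest confines the velocity of \<open>k\<close> to the normal line of that bar;
    on a hyperbola the two bars have different slopes, so these lines meet only in 0.\<close>
  have extend: "A k = 0 \<and> B k = 0"
    if "k < m" "v < m" "w < m" "v \<noteq> w" "adj k v" "adj k w"
      and "A v = 0 \<and> B v = 0" "A w = 0 \<and> B w = 0" for k v w
  proof -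
    have "(real k + 1) * (real v + 1) * A k = B k" "(real k + 1) * (real w + 1) * A k = B k"
      using edge[of k v] edge[of k w] that by auto
    then have "(real k + 1) * A k * (real v - real w) = 0" and Bk: "B k = (real k + 1) * (real v + 1) * A k"
      by (simp_all add: algebra_simps)
    then have "A k = 0" using \<open>v \<noteq> w\<close> by auto
    with Bk show ?thesis by simp
  qed
  have 0: "A 0 = 0 \<and> B 0 = 0" by (simp add: A_def B_def \<alpha>_def \<beta>_def)
  have "B 2 = 0" by (simp add: B_def \<beta>_def \<omega>_def field_simps)
  with 0 edge[of 0 2] have 2: "A 2 = 0 \<and> B 2 = 0"
    using \<open>m \<ge> 6\<close> by (simp add: adj_def)
  have ge4: "A k = 0 \<and> B k = 0" if "k < m" "4 \<le> k" for k
    using extend[of k 0 2] 0 2 that by (simp add: adj_def)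
  have 3: "A 3 = 0 \<and> B 3 = 0"
    using extend[of 3 0 5] 0 ge4[of 5] \<open>m \<ge> 6\<close> by (simp add: adj_def)
  have 1: "A 1 = 0 \<and> B 1 = 0"
    using extend[of 1 4 5] ge4[of 4] ge4[of 5] \<open>m \<ge> 6\<close> by (simp add: adj_def)
  have "A v = 0 \<and> B v = 0" if "v < m" for v
  proof -
    have "v = 0 \<or> v = 1 \<or> v = 2 \<or> v = 3 \<or> 4 \<le> v" by linarith
    with 0 1 2 3 ge4 that show ?thesis by metis
  qed
  then show ?thesis
    unfolding A_def B_def
    by (intro exI[of _ \<omega>] exI[of _ \<alpha>] exI[of _ \<beta>]) (auto simp: algebra_simps)
qed

section \<open>The placement on two levels over the hyperbola\<close>

definition zigzag :: "nat \<Rightarrow> real ^ 3" where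
  "zigzag i = vector [real i + 1, 1 / (real i + 1), if even i then 0 else 2]"

lemma zigzag_nth [simp]:
  "zigzag i $ 1 = real i + 1" "zigzag i $ 2 = 1 / (real i + 1)"
  "zigzag i $ 3 = (if even i then 0 else 2)"
  by (simp_all add: zigzag_def)

lemma zigzag_consecutive_vertical:
  assumes "u = zigzag i - zigzag (Suc i)"
  shows "(u $ 1)\<^sup>2 + (u $ 2)\<^sup>2 < (u $ 3)\<^sup>2"
proof -
  have "0 \<le> 1 / (real i + 1)" "1 / (real i + 1) \<le> 1"
    "0 \<le> 1 / (real i + 2)" "1 / (real i + 2) \<le> 1"
    by simp_all
  moreover have "u $ 2 = 1 / (real i + 1) - 1 / (real i + 2)"
    by (simp add: assms add_ac)
  ultimately have "\<bar>u $ 2\<bar> \<le> 1" by linarith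
  then have "(u $ 2)\<^sup>2 \<le> 1" by (simp add: abs_square_le_1)
  then show ?thesis by (simp add: assms)
qed

lemma zigzag_nonconsecutive_horizontal:
  assumes "u = zigzag i - zigzag j" and "i + 1 < j"
  shows "(u $ 3)\<^sup>2 < (u $ 1)\<^sup>2 + (u $ 2)\<^sup>2"
proof (cases "even i = even j")
  case True
  then have "u $ 3 = 0" "u $ 1 \<noteq> 0" using assms by auto
  then show ?thesis by (simp add: add_pos_nonneg)
next
  case False
  then have "j \<noteq> i + 2" by auto
  with assms(2) have "3 \<le> real j - real i" by linarith
  then have "3\<^sup>2 \<le> (real j - real i)\<^sup>2" by (rule power_mono) simp
  then have "9 \<le> (u $ 1)\<^sup>2" by (simp add: assms(1) power2_commute)
  moreover have "(u $ 3)\<^sup>2 = 4" using False by (auto simp: assms(1))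
  ultimately show ?thesis using zero_le_power2[of "u $ 2"] by linarith
qed

lemma zigzag_off_cone:
  assumes "i \<noteq> j" and "u = zigzag i - zigzag j"
  shows "(u $ 1)\<^sup>2 + (u $ 2)\<^sup>2 \<noteq> (u $ 3)\<^sup>2"
proof -
  have less: "(u $ 1)\<^sup>2 + (u $ 2)\<^sup>2 \<noteq> (u $ 3)\<^sup>2" if "i < j" "u = zigzag i - zigzag j" for i j u
    using that zigzag_consecutive_vertical[of u i] zigzag_nonconsecutive_horizontal[of u i j]
    by (cases "j = Suc i") auto
  show ?thesis
  proof (cases "i < j")
    case True then show ?thesis using less assms by blast
  next
    case False
    then have "((- u) $ 1)\<^sup>2 + ((- u) $ 2)\<^sup>2 \<noteq> ((- u) $ 3)\<^sup>2"
      using assms by (intro less[of j i]) auto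
    then show ?thesis by simp
  qed
qed

lemma zigzag_inj: "zigzag i = zigzag j \<longleftrightarrow> i = j"
proof
  assume "zigzag i = zigzag j"
  then have "zigzag i $ 1 = zigzag j $ 1" by simp
  then show "i = j" by simp
qed simp

text \<open>A velocity field that satisfies the first-order condition on every edge splits into its
  vertical part, constant along the path of consecutive vertices, and its horizontal part, a flex of
  the path complement in the plane.\<close>

lemma zigzag_flex_trivial:
  fixes c :: "nat \<Rightarrow> real ^ 3"
  assumes "m \<ge> 6"
    and flex: "\<And>v w. v < m \<Longrightarrow> w < m \<Longrightarrow> v < w \<Longrightarrow>
      cyl_gradient (zigzag v - zigzag w) (c v - c w) = 0"
  shows "\<exists>\<omega> d. \<forall>v<m. c v = vector [- \<omega> * zigzag v $ 2, \<omega> * zigzag v $ 1, 0] + d"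
proof -
  have vertical: "c v $ 3 = c 0 $ 3" if "v < m" for v
    using that
  proof (induction v)
    case (Suc v)
    define u where "u = zigzag v - zigzag (Suc v)"
    have "sqrt ((u $ 1)\<^sup>2 + (u $ 2)\<^sup>2) < \<bar>u $ 3\<bar>"
      using real_sqrt_less_mono[OF zigzag_consecutive_vertical[OF u_def]] by simp
    then have "cyl_gradient u (c v - c (Suc v)) = sgn (u $ 3) * (c v $ 3 - c (Suc v) $ 3)"
      by (simp add: cyl_gradient_def)
    moreover have "u $ 3 \<noteq> 0" by (simp add: u_def)
    ultimately have "c v $ 3 = c (Suc v) $ 3"
      using flex[of v "Suc v"] Suc.prems by (simp add: u_def[symmetric] sgn_zero_iff)
    with Suc show ?case by simp
  qed simp
  have "\<exists>\<omega> \<alpha> \<beta>. \<forall>v<m. c v $ 1 = \<alpha> - \<omega> / (real v + 1) \<and> c v $ 2 = \<beta> + \<omega> * (real v + 1)"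
  proof (rule path_complement_on_hyperbola_rigid[OF \<open>m \<ge> 6\<close>])
    fix v w assume vw: "v < m" "w < m" "v + 1 < w"
    define u where "u = zigzag v - zigzag w"
    define s where "s = real v + 1"
    define t where "t = real w + 1"
    have st: "s > 0" "t > 0" "s \<noteq> t" using vw by (auto simp: s_def t_def)
    have "\<bar>u $ 3\<bar> < sqrt ((u $ 1)\<^sup>2 + (u $ 2)\<^sup>2)"
      using real_sqrt_less_mono[OF zigzag_nonconsecutive_horizontal[OF u_def vw(3)]] by simp
    moreover from this have "sqrt ((u $ 1)\<^sup>2 + (u $ 2)\<^sup>2) \<noteq> 0" by linarith
    moreover have "cyl_gradient u (c v - c w) = 0"
      using flex[of v w] vw by (simp add: u_def)
    ultimately have "u $ 1 * (c v $ 1 - c w $ 1) + u $ 2 * (c v $ 2 - c w $ 2) = 0"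
      by (auto simp: cyl_gradient_def)
    then have "(s - t) * (c v $ 1 - c w $ 1) + (1 / s - 1 / t) * (c v $ 2 - c w $ 2) = 0"
      by (simp add: u_def s_def t_def)
    moreover have "1 / s - 1 / t = - (s - t) / (s * t)"
      using st by (simp add: field_simps)
    ultimately have "(s - t) * (s * t * (c v $ 1 - c w $ 1) - (c v $ 2 - c w $ 2)) = 0"
      using st by (simp add: field_simps)
    then show "(real v + 1) * (real w + 1) * (c v $ 1 - c w $ 1) = c v $ 2 - c w $ 2"
      using st by (simp add: s_def t_def)
  qed
  then obtain \<omega> \<alpha> \<beta>
    where horizontal: "\<forall>v<m. c v $ 1 = \<alpha> - \<omega> / (real v + 1) \<and> c v $ 2 = \<beta> + \<omega> * (real v + 1)"
    by blast
  have "c v = vector [- \<omega> * zigzag v $ 2, \<omega> * zigzag v $ 1, 0] + vector [\<alpha>, \<beta>, c 0 $ 3]"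
    if "v < m" for v
    unfolding vec_eq_iff forall_3 using horizontal[rule_format, OF that] vertical[OF that]
    by (auto simp: algebra_simps)
  then show ?thesis by blast
qed

section \<open>Rotation about the vertical axis with a uniform drift\<close>

definition rotate_drift :: "real \<Rightarrow> real ^ 3 \<Rightarrow> real ^ 3 \<Rightarrow> real \<Rightarrow> real ^ 3" where
  "rotate_drift \<omega> d u t =
     vector [cos (\<omega> * t) * u $ 1 - sin (\<omega> * t) * u $ 2, sin (\<omega> * t) * u $ 1 + cos (\<omega> * t) * u $ 2, u $ 3]
       + t *\<^sub>R d"

lemma rotate_drift_nth:
  "rotate_drift \<omega> d u t $ 1 = cos (\<omega> * t) * u $ 1 - sin (\<omega> * t) * u $ 2 + t * d $ 1"
  "rotate_drift \<omega> d u t $ 2 = sin (\<omega> * t) * u $ 1 + cos (\<omega> * t) * u $ 2 + t * d $ 2"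
  "rotate_drift \<omega> d u t $ 3 = u $ 3 + t * d $ 3"
  by (simp_all add: rotate_drift_def)

lemma rotate_drift_0: "rotate_drift \<omega> d u 0 = u"
  by (simp add: rotate_drift_def vec_eq_iff forall_3)

lemma cyl_norm_rotate_drift_diff: "cyl_norm (rotate_drift \<omega> d u t - rotate_drift \<omega> d v t) = cyl_norm (u - v)"
proof -
  have rot: "(C * x - S * y)\<^sup>2 + (S * x + C * y)\<^sup>2 = x\<^sup>2 + y\<^sup>2" if "S\<^sup>2 + C\<^sup>2 = 1" for C S x y :: real
  proof -
    have "(C * x - S * y)\<^sup>2 + (S * x + C * y)\<^sup>2 = (S\<^sup>2 + C\<^sup>2) * (x\<^sup>2 + y\<^sup>2)"
      by (simp add: power2_eq_square algebra_simps)
    with that show ?thesis by simp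
  qed
  have diff: "(rotate_drift \<omega> d u t - rotate_drift \<omega> d v t) $ 1
      = cos (\<omega> * t) * (u $ 1 - v $ 1) - sin (\<omega> * t) * (u $ 2 - v $ 2)"
    "(rotate_drift \<omega> d u t - rotate_drift \<omega> d v t) $ 2
      = sin (\<omega> * t) * (u $ 1 - v $ 1) + cos (\<omega> * t) * (u $ 2 - v $ 2)"
    "(rotate_drift \<omega> d u t - rotate_drift \<omega> d v t) $ 3 = u $ 3 - v $ 3"
    by (simp_all add: rotate_drift_def algebra_simps)
  show ?thesis
    unfolding cyl_norm_def diff rot[OF sin_cos_squared_add] by simp
qed

lemma continuous_on_rotate_drift: "continuous_on S (rotate_drift \<omega> d u)"
proof -
  have "continuous_on S (\<lambda>t. rotate_drift \<omega> d u t $ i)" for i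
    using exhaust_3[of i]
    by (elim disjE; hypsubst; unfold rotate_drift_nth; intro continuous_intros)
  then have "continuous_on S (\<lambda>t. \<chi> i. rotate_drift \<omega> d u t $ i)"
    by (rule continuous_on_vec_lambda)
  then show ?thesis by simp
qed

lemma rotate_drift_derivative_0:
  "(rotate_drift \<omega> d u has_vector_derivative vector [- \<omega> * u $ 2, \<omega> * u $ 1, 0] + d) (at 0)"
proof -
  define V where "V = vector [- \<omega> * u $ 2, \<omega> * u $ 1, 0] + d"
  have "((\<lambda>t. rotate_drift \<omega> d u t $ i) has_real_derivative V $ i) (at 0)" for i
    using exhaust_3[of i] by (auto simp: rotate_drift_nth V_def intro!: derivative_eq_intros)
  then have "((\<lambda>t. rotate_drift \<omega> d u t $ i) has_derivative (\<lambda>x. x * V $ i)) (at 0)" for i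
    by (simp add: has_field_derivative_def mult_commute_abs)
  then have "(rotate_drift \<omega> d u has_vector_derivative V) (at 0)"
    unfolding has_vector_derivative_def
    by (subst has_derivative_componentwise_within) (auto simp: Basis_vec_def inner_axis)
  then show ?thesis by (simp add: V_def)
qed

section \<open>Transfer to an arbitrary cylindrical space\<close>

theorem theorem5p7:
  fixes m :: nat
  assumes "cylindrical_normed_space TYPE('a::real_normed_vector)"
    and "m \<ge> 6"
  shows "\<exists>p :: nat \<Rightarrow> 'a.
           well_positioned (complete_graph m) p \<and> infinitesimally_rigid (complete_graph m) p"
proof -
  obtain \<Phi> :: "'a \<Rightarrow> real ^ 3"
    where lin: "linear \<Phi>" and bij: "bij \<Phi>" and iso: "\<And>x. cyl_norm (\<Phi> x) = norm x"
    using assms(1) unfolding cylindrical_normed_space_def by blast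
  define \<Psi> where "\<Psi> = inv \<Phi>"
  have \<Phi>\<Psi> [simp]: "\<Phi> (\<Psi> u) = u" for u
    unfolding \<Psi>_def using bij by (simp add: bij_is_surj surj_f_inv_f)
  have \<Psi>\<Phi> [simp]: "\<Psi> (\<Phi> x) = x" for x
    unfolding \<Psi>_def using bij by (simp add: bij_is_inj)
  have norm_\<Psi>: "norm (\<Psi> u) = cyl_norm u" for u
    using iso[of "\<Psi> u"] by simp
  have lin_\<Psi>: "linear \<Psi>"
  proof (rule linearI)
    show "\<Psi> (u + v) = \<Psi> u + \<Psi> v" for u v
      by (metis \<Phi>\<Psi> \<Psi>\<Phi> linear_add[OF lin])
    show "\<Psi> (r *\<^sub>R u) = r *\<^sub>R \<Psi> u" for r u
      by (metis \<Phi>\<Psi> \<Psi>\<Phi> linear_scale[OF lin])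
  qed
  then have blin_\<Psi>: "bounded_linear \<Psi>"
    by (rule linear_conv_bounded_linear[THEN iffD1])

  define p where "p i = \<Psi> (zigzag i)" for i
  have \<Phi>_diff: "\<Phi> (p v - p w) = zigzag v - zigzag w" for v w
    by (simp add: p_def linear_diff[OF lin])
  have edge_iff: "{v, w} \<in> snd (complete_graph m) \<longleftrightarrow> v < m \<and> w < m \<and> v \<noteq> w" for v w
    by (auto simp: complete_graph_def card_2_iff')
  have p_neq: "p v \<noteq> p w" if "v \<noteq> w" for v w
    using that by (metis \<Phi>\<Psi> p_def zigzag_inj)
  have fw: "framework (complete_graph m) p"
    unfolding framework_def edge_iff
    using p_neq by (auto simp: finite_simple_graph_def complete_graph_def)
  have der: "((\<lambda>t. norm (p v - p w + t *\<^sub>R y)) has_real_derivative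
      cyl_gradient (zigzag v - zigzag w) (\<Phi> y)) (at 0)" if "v \<noteq> w" for v w y
    using cyl_norm_directional_derivative[OF zigzag_off_cone[OF that refl], of "\<Phi> y"]
    by (simp add: iso[symmetric] linear_add[OF lin] linear_scale[OF lin] \<Phi>_diff)

  have "norm_smooth_at (p v - p w)" if "v \<noteq> w" for v w
  proof (rule norm_smooth_at_if_directional_derivative)
    show "p v - p w \<noteq> 0" using p_neq[OF that] by simp
    show "linear (\<lambda>y. cyl_gradient (zigzag v - zigzag w) (\<Phi> y))"
      using linear_compose[OF lin linear_cyl_gradient] by (simp add: o_def)
  qed (rule der[OF that])
  then have wp: "well_positioned (complete_graph m) p"
    unfolding well_positioned_def edge_iff using fw by blast

  have "trivial_flex (complete_graph m) p z" if flex: "infinitesimal_flex (complete_graph m) p z" for z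
  proof -
    have "cyl_gradient (zigzag v - zigzag w) (\<Phi> (z v) - \<Phi> (z w)) = 0"
      if "v < m" "w < m" "v < w" for v w
    proof -
      have "((\<lambda>t. 1 / t * (norm (p v + t *\<^sub>R z v - (p w + t *\<^sub>R z w)) - norm (p v - p w))) \<longlongrightarrow> 0) (at 0)"
        using flex that unfolding infinitesimal_flex_def edge_iff edge_length_def by auto
      moreover have "p v + t *\<^sub>R z v - (p w + t *\<^sub>R z w) = p v - p w + t *\<^sub>R (z v - z w)" for t
        by (simp add: algebra_simps)
      ultimately have "((\<lambda>t. norm (p v - p w + t *\<^sub>R (z v - z w))) has_real_derivative 0) (at 0)"
        by (simp add: DERIV_def)
      then show ?thesis
        using DERIV_unique[OF der[of v w "z v - z w"]] that by (simp add: linear_diff[OF lin])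
    qed
    then obtain \<omega> d
      where c: "\<And>v. v < m \<Longrightarrow> \<Phi> (z v) = vector [- \<omega> * zigzag v $ 2, \<omega> * zigzag v $ 1, 0] + d"
      using zigzag_flex_trivial[OF \<open>m \<ge> 6\<close>, of "\<lambda>v. \<Phi> (z v)"] by blast
    define \<alpha> where "\<alpha> x t = \<Psi> (rotate_drift \<omega> d (\<Phi> x) t)" for x t
    define \<eta> where "\<eta> x = \<Psi> (vector [- \<omega> * \<Phi> x $ 2, \<omega> * \<Phi> x $ 1, 0] + d)" for x
    have \<alpha>_der: "(\<alpha> x has_vector_derivative \<eta> x) (at 0)" for x
      unfolding \<alpha>_def \<eta>_def
      by (rule bounded_linear.has_vector_derivative[OF blin_\<Psi> rotate_drift_derivative_0])
    have "rigid_motion \<alpha>"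
      unfolding rigid_motion_def
    proof (intro conjI allI ballI)
      fix x y :: 'a and t :: real
      show "continuous_on {-1..1} (\<alpha> x)"
        unfolding \<alpha>_def by (rule bounded_linear.continuous_on[OF blin_\<Psi> continuous_on_rotate_drift])
      show "\<alpha> x 0 = x" by (simp add: \<alpha>_def rotate_drift_0)
      show "\<alpha> x differentiable (at 0)"
        using \<alpha>_der by (rule differentiableI_vector)
      have "norm (\<alpha> x t - \<alpha> y t) = cyl_norm (rotate_drift \<omega> d (\<Phi> x) t - rotate_drift \<omega> d (\<Phi> y) t)"
        unfolding \<alpha>_def by (simp add: linear_diff[OF lin_\<Psi>, symmetric] norm_\<Psi>)
      also have "\<dots> = cyl_norm (\<Phi> (x - y))"
        by (simp add: cyl_norm_rotate_drift_diff linear_diff[OF lin])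
      finally show "norm (\<alpha> x t - \<alpha> y t) = norm (x - y)" by (simp add: iso)
    qed
    with \<alpha>_der have "\<eta> \<in> infinitesimal_rigid_motions"
      unfolding infinitesimal_rigid_motions_def by blast
    moreover have "z v = \<eta> (p v)" if "v < m" for v
      using c[OF that] \<Psi>\<Phi>[of "z v"] by (simp add: \<eta>_def p_def)
    ultimately show ?thesis
      unfolding trivial_flex_def using flex by (auto simp: complete_graph_def)
  qed
  then have "infinitesimally_rigid (complete_graph m) p"
    unfolding infinitesimally_rigid_def using fw by blast
  with wp show ?thesis by blast
qed

end
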